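(* Let $\nu,\tau>0$. Under the solvability condition $(P^{n+\frac12},1)_h=0$, both of the following fully discrete CN schemes are uniquely solvable; that is, at each time step, given the previously computed velocities, there is exactly one pair $(\bm U^{n+1},P^{n+\frac12})\in[V_{ew};V_{ns}]\times V_c$ with $(P^{n+\frac12},1)_h=0$ satisfying the scheme. Here $\bm U^{n+\frac12}=(\bm U^n+\bm U^{n+1})/2$. CN1: given $\bm U^0\in[V_{ew};V_{ns}]$, for $0\le n\le N_t-1$, $$\frac{\bm U^{n+1}-\bm U^n}{\tau}-\nu\Delta_h\bm U^{n+\frac12}+\bm B(\bm U^n,\bm U^{n+\frac12})+\nabla_DP^{n+\frac12}=\mathscr F^{n+\frac12},\qquad \nabla_d\cdot\bm U^{n+\frac12}=\bm 0 .$$ CN2: given $\bm U^0\in[V_{ew};V_{ns}]$, and $\bm U^1$ obtained from the CN1 scheme, for $1\le n\le N_t-1$, $$\frac{\bm U^{n+1}-\bm U^n}{\tau}-\nu\Delta_h\bm U^{n+\frac12}+\bm B(\overline{\bm U}^{n+\frac12},\bm U^{n+\frac12})+\nabla_DP^{n+\frac12}=\mathscr F^{n+\frac12},\qquad \nabla_d\cdot\bm U^{n+\frac12}=\bm 0,$$ with $\overline{\bm U}^{n+\frac12}=(3\bm U^n-\bm U^{n-1})/2$.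
   Context: Setting: two space dimensions with periodic boundary conditions on $[0,L_x]\times[0,L_y]$; $N_x,N_y,N_t$ are positive integers, $h_x=L_x/N_x$, $h_y=L_y/N_y$, $T>0$, $\tau=T/N_t$. $V_{ew},V_{ns},V_c$ are the spaces of real grid functions on, respectively, the points $(x_{i+1/2},y_j)$ ($0\le i\le N_x-1$, $1\le j\le N_y$), $(x_i,y_{j+1/2})$ ($1\le i\le N_x$, $0\le j\le N_y-1$), $(x_i,y_j)$ ($1\le i\le N_x$, $1\le j\le N_y$), where $x_l=(l-\frac12)h_x$, $y_l=(l-\frac12)h_y$; each is identified with the real $N_x\times N_y$ matrices. $[V_{ew};V_{ns}]$ is the space of pairs $\bm U=[U;V]$ with $U\in V_{ew}$, $V\in V_{ns}$. For matrices of equal size, $(A,B)_h=h_xh_y\mathrm{Tr}(A^TB)$, $\|A\|_h=\sqrt{(A,A)_h}$; for pairs, the inner products of the components are summed. In $(P,1)_h$, $1$ is the all-ones grid function. Differentiation matrices ($N\times N$, acting on $w\in\mathbb R^N$ with indices modulo $N$): $(\mathbb C(N)w)_i=\frac12(w_i+w_{i+1})$, $(\mathbb D_1(N,h)w)_i=\frac{1}{2h}(w_{i+1}-w_{i-1})$, $(\mathbb D_2(N,h)w)_i=\frac1h(w_{i+1}-w_i)$, $(\mathbb D_3(N,h)w)_i=\frac1{h^2}(w_{i+1}-2w_i+w_{i-1})$. Put $\mathbb A_1=\mathbb C(N_x)$, $\mathbb A_2=\mathbb D_1(N_x,h_x)$, $\mathbb A_3=\mathbb D_2(N_x,h_x)$,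 $\mathbb A_4=\mathbb D_3(N_x,h_x)$, and $\mathbb B_1=\mathbb C(N_y)$, $\mathbb B_2=\mathbb D_1(N_y,h_y)$, $\mathbb B_3=\mathbb D_2(N_y,h_y)$, $\mathbb B_4=\mathbb D_3(N_y,h_y)$. Discrete operators: $\nabla_d\cdot\bm U=\mathbb A_3U+V\mathbb B_3^T\in V_c$; $\nabla_DP=[-\mathbb A_3^TP;\,-P\mathbb B_3]\in[V_{ew};V_{ns}]$; $\Delta_hW=\mathbb A_4W+W\mathbb B_4^T$, applied componentwise to pairs. $\bm F:[V_{ew};V_{ns}]\to[V_{ew};V_{ns}]$ is a given map with $(\bm F(\bm U),\bm U)_h\ne0$ whenever $\|\bm U\|_h\neq0$. $\bm G(\bm U)=[G_1(\bm U);G_2(\bm U)]$ is $\bm 0$ if $\|\bm U\|_h=0$, and otherwise $$G_1(\bm U)=\frac{U\odot(\mathbb A_2U)-\big((\mathbb A_1^TV)\odot(U\mathbb B_3)\big)\mathbb B_1^T}{(\bm F(\bm U),\bm U)_h},\qquad G_2(\bm U)=\frac{V\odot(V\mathbb B_2^T)-\mathbb A_1\big((\mathbb A_3^TV)\odot(U\mathbb B_1)\big)}{(\bm F(\bm U),\bm U)_h},$$ with $\odot$ the Hadamard (entrywise) product. For $\bm U,\bm W\in[V_{ew};V_{ns}]$, $$\bm B(\bm U,\bm W)=\big(\bm F(\bm U),\bm W\big)_h\bm G(\bm U)-\big(\bm G(\bm U),\bm W\big)_h\bm F(\bm U).$$ $\mathscr F^{n+\frac12}\in[V_{ew};V_{ns}]$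 is the given spatial discretization of the external force. *)

theory Defs
  imports Complex_Main "HOL-Library.Product_Plus" "HOL-Library.FuncSet"
    "Jordan_Normal_Form.Matrix"
begin

text \<open>
  Grid functions on each of the three staggered grids are real \<open>Nx \<times> Ny\<close> matrices. Rows and
  columns are numbered from \<open>0\<close>, in the order in which the grid points are listed; since the
  differentiation matrices are circulant, this shift of the index range is immaterial.
  A pair \<open>(U, V)\<close> stands for \<open>[U; V]\<close>.
\<close>

type_synonym mat_pair = "real mat \<times> real mat"

abbreviation grid_space :: "nat \<Rightarrow> nat \<Rightarrow> real mat set" where
  "grid_space Nx Ny \<equiv> carrier_mat Nx Ny"

definition velocity_space :: "nat \<Rightarrow> nat \<Rightarrow> mat_pair set" where
  "velocity_space Nx Ny = grid_space Nx Ny \<times> grid_space Nx Ny"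

text \<open>Sums and differences of pairs are those of \<open>HOL-Library.Product_Plus\<close>.\<close>

definition smult_pair :: "real \<Rightarrow> mat_pair \<Rightarrow> mat_pair" (infixl "\<cdot>\<^sub>p" 70) where
  "c \<cdot>\<^sub>p U = (c \<cdot>\<^sub>m fst U, c \<cdot>\<^sub>m snd U)"

definition zero_pair :: "nat \<Rightarrow> nat \<Rightarrow> mat_pair" where
  "zero_pair Nx Ny = (0\<^sub>m Nx Ny, 0\<^sub>m Nx Ny)"

definition ones_mat :: "nat \<Rightarrow> nat \<Rightarrow> real mat" where
  "ones_mat Nx Ny = mat Nx Ny (\<lambda>_. 1)"

definition mat_trace :: "real mat \<Rightarrow> real" where
  "mat_trace A = (\<Sum>i<dim_row A. A $$ (i, i))"

definition hadamard :: "real mat \<Rightarrow> real mat \<Rightarrow> real mat" (infixl "\<odot>" 70) where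
  "A \<odot> B = mat (dim_row A) (dim_col A) (\<lambda>ij. A $$ ij * B $$ ij)"

definition inner_h :: "real \<Rightarrow> real \<Rightarrow> real mat \<Rightarrow> real mat \<Rightarrow> real" where
  "inner_h hx hy A B = hx * hy * mat_trace (transpose_mat A * B)"

definition inner_pair_h :: "real \<Rightarrow> real \<Rightarrow> mat_pair \<Rightarrow> mat_pair \<Rightarrow> real" where
  "inner_pair_h hx hy U W = inner_h hx hy (fst U) (fst W) + inner_h hx hy (snd U) (snd W)"

definition norm_pair_h :: "real \<Rightarrow> real \<Rightarrow> mat_pair \<Rightarrow> real" where
  "norm_pair_h hx hy U = sqrt (inner_pair_h hx hy U U)"


subsection \<open>Periodic differentiation matrices\<close>

text \<open>
  The cyclic predecessor of \<open>i\<close> is written \<open>(i + N - 1) mod N\<close>, because subtraction on \<^typ>\<open>nat\<close>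
  truncates. The entries are sums, so that coinciding neighbours (\<open>N = 1\<close> and \<open>N = 2\<close>) accumulate;
  the lemmas below give the resulting action on vectors.
\<close>

definition mat_C :: "nat \<Rightarrow> real mat" where
  "mat_C N = mat N N (\<lambda>(i, j).
     1 / 2 * (of_bool (j = i) + of_bool (j = (i + 1) mod N)))"

definition mat_D1 :: "nat \<Rightarrow> real \<Rightarrow> real mat" where
  "mat_D1 N h = mat N N (\<lambda>(i, j).
     1 / (2 * h) * (of_bool (j = (i + 1) mod N) - of_bool (j = (i + N - 1) mod N)))"

definition mat_D2 :: "nat \<Rightarrow> real \<Rightarrow> real mat" where
  "mat_D2 N h = mat N N (\<lambda>(i, j).
     1 / h * (of_bool (j = (i + 1) mod N) - of_bool (j = i)))"

definition mat_D3 :: "nat \<Rightarrow> real \<Rightarrow> real mat" where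
  "mat_D3 N h = mat N N (\<lambda>(i, j).
     1 / h\<^sup>2 * (of_bool (j = (i + 1) mod N) - 2 * of_bool (j = i) + of_bool (j = (i + N - 1) mod N)))"

lemma sum_of_bool_index:
  fixes f :: "nat \<Rightarrow> real"
  assumes "a < N"
  shows "(\<Sum>j = 0..<N. of_bool (j = a) * f j) = f a"
proof -
  have "(\<Sum>j = 0..<N. of_bool (j = a) * f j) = (\<Sum>j = 0..<N. if j = a then f j else 0)"
    by (rule sum.cong) auto
  then show ?thesis
    using assms by simp
qed

context
  fixes N i :: nat and w :: "real vec"
  assumes w: "w \<in> carrier_vec N" and i: "i < N"
begin

private lemma nbr: "(i + 1) mod N < N" "(i + N - 1) mod N < N"
  using i by auto

lemma mat_C_action:
  "(mat_C N *\<^sub>v w) $ i = 1 / 2 * (w $ i + w $ ((i + 1) mod N))"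
proof -
  have "(mat_C N *\<^sub>v w) $ i
      = (\<Sum>j = 0..<N. 1 / 2 * (of_bool (j = i) * w $ j + of_bool (j = (i + 1) mod N) * w $ j))"
    using w i by (auto simp: mat_C_def scalar_prod_def intro!: sum.cong)
  then show ?thesis
    by (simp only: sum_distrib_left [symmetric] sum.distrib sum_of_bool_index i nbr)
qed

lemma mat_D1_action:
  "(mat_D1 N h *\<^sub>v w) $ i = 1 / (2 * h) * (w $ ((i + 1) mod N) - w $ ((i + N - 1) mod N))"
proof -
  have "(mat_D1 N h *\<^sub>v w) $ i = (\<Sum>j = 0..<N. 1 / (2 * h) *
      (of_bool (j = (i + 1) mod N) * w $ j - of_bool (j = (i + N - 1) mod N) * w $ j))"
    using w i by (auto simp: mat_D1_def scalar_prod_def algebra_simps intro!: sum.cong)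
  then show ?thesis
    by (simp only: sum_distrib_left [symmetric] sum_subtractf sum_of_bool_index nbr)
qed

lemma mat_D2_action:
  "(mat_D2 N h *\<^sub>v w) $ i = 1 / h * (w $ ((i + 1) mod N) - w $ i)"
proof -
  have "(mat_D2 N h *\<^sub>v w) $ i = (\<Sum>j = 0..<N. 1 / h *
      (of_bool (j = (i + 1) mod N) * w $ j - of_bool (j = i) * w $ j))"
    using w i by (auto simp: mat_D2_def scalar_prod_def algebra_simps intro!: sum.cong)
  then show ?thesis
    by (simp only: sum_distrib_left [symmetric] sum_subtractf sum_of_bool_index i nbr)
qed

lemma mat_D3_action:
  "(mat_D3 N h *\<^sub>v w) $ i
     = 1 / h\<^sup>2 * (w $ ((i + 1) mod N) - 2 * w $ i + w $ ((i + N - 1) mod N))"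
proof -
  have "(mat_D3 N h *\<^sub>v w) $ i = (\<Sum>j = 0..<N. 1 / h\<^sup>2 *
      (of_bool (j = (i + 1) mod N) * w $ j - 2 * (of_bool (j = i) * w $ j)
        + of_bool (j = (i + N - 1) mod N) * w $ j))"
    using w i by (auto simp: mat_D3_def scalar_prod_def algebra_simps intro!: sum.cong)
  then show ?thesis
    by (simp only: sum_distrib_left [symmetric] sum.distrib sum_subtractf sum_of_bool_index i nbr)
qed

end


subsection \<open>Discrete operators\<close>

definition div_d :: "nat \<Rightarrow> nat \<Rightarrow> real \<Rightarrow> real \<Rightarrow> mat_pair \<Rightarrow> real mat" where
  "div_d Nx Ny hx hy U = mat_D2 Nx hx * fst U + snd U * transpose_mat (mat_D2 Ny hy)"

definition grad_D :: "nat \<Rightarrow> nat \<Rightarrow> real \<Rightarrow> real \<Rightarrow> real mat \<Rightarrow> mat_pair" where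
  "grad_D Nx Ny hx hy P = (- (transpose_mat (mat_D2 Nx hx) * P), - (P * mat_D2 Ny hy))"

definition laplace_h :: "nat \<Rightarrow> nat \<Rightarrow> real \<Rightarrow> real \<Rightarrow> real mat \<Rightarrow> real mat" where
  "laplace_h Nx Ny hx hy W = mat_D3 Nx hx * W + W * transpose_mat (mat_D3 Ny hy)"

definition laplace_pair_h :: "nat \<Rightarrow> nat \<Rightarrow> real \<Rightarrow> real \<Rightarrow> mat_pair \<Rightarrow> mat_pair" where
  "laplace_pair_h Nx Ny hx hy U = (laplace_h Nx Ny hx hy (fst U), laplace_h Nx Ny hx hy (snd U))"

definition op_G ::
  "nat \<Rightarrow> nat \<Rightarrow> real \<Rightarrow> real \<Rightarrow> (mat_pair \<Rightarrow> mat_pair) \<Rightarrow> mat_pair \<Rightarrow> mat_pair" where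
  "op_G Nx Ny hx hy F UV =
     (if norm_pair_h hx hy UV = 0 then zero_pair Nx Ny
      else
        let U = fst UV; V = snd UV;
            A1 = mat_C Nx; A2 = mat_D1 Nx hx; A3 = mat_D2 Nx hx;
            B1 = mat_C Ny; B2 = mat_D1 Ny hy; B3 = mat_D2 Ny hy
        in (1 / inner_pair_h hx hy (F UV) UV) \<cdot>\<^sub>p
             (U \<odot> (A2 * U) - ((transpose_mat A1 * V) \<odot> (U * B3)) * transpose_mat B1,
              V \<odot> (V * transpose_mat B2) - A1 * ((transpose_mat A3 * V) \<odot> (U * B1))))"

definition op_B ::
  "nat \<Rightarrow> nat \<Rightarrow> real \<Rightarrow> real \<Rightarrow> (mat_pair \<Rightarrow> mat_pair) \<Rightarrow> mat_pair \<Rightarrow> mat_pair \<Rightarrow> mat_pair" where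
  "op_B Nx Ny hx hy F U W =
     inner_pair_h hx hy (F U) W \<cdot>\<^sub>p op_G Nx Ny hx hy F U
     - inner_pair_h hx hy (op_G Nx Ny hx hy F U) W \<cdot>\<^sub>p F U"


subsection \<open>The Crank--Nicolson schemes\<close>

text \<open>
  One step from \<open>U0 = U\<^sup>n\<close> to \<open>U1 = U\<^sup>n\<^sup>+\<^sup>1\<close> with pressure \<open>P = P\<^sup>n\<^sup>+\<^sup>1\<^sup>/\<^sup>2\<close>, forcing \<open>f\<close> at the
  half step and first argument \<open>A\<close> of \<open>B\<close>. The two schemes differ only in \<open>A\<close>.
\<close>

definition CN_step ::
  "nat \<Rightarrow> nat \<Rightarrow> real \<Rightarrow> real \<Rightarrow> real \<Rightarrow> real \<Rightarrow> (mat_pair \<Rightarrow> mat_pair) \<Rightarrow>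
   mat_pair \<Rightarrow> mat_pair \<Rightarrow> mat_pair \<Rightarrow> mat_pair \<Rightarrow> real mat \<Rightarrow> bool" where
  "CN_step Nx Ny hx hy \<tau> \<nu> F f A U0 U1 P \<longleftrightarrow>
     (let Uhalf = (1 / 2) \<cdot>\<^sub>p (U0 + U1) in
        (1 / \<tau>) \<cdot>\<^sub>p (U1 - U0) - \<nu> \<cdot>\<^sub>p laplace_pair_h Nx Ny hx hy Uhalf
          + op_B Nx Ny hx hy F A Uhalf + grad_D Nx Ny hx hy P = f
        \<and> div_d Nx Ny hx hy Uhalf = 0\<^sub>m Nx Ny)"

text \<open>
  The pairs \<open>(U\<^sup>n\<^sup>+\<^sup>1, P\<^sup>n\<^sup>+\<^sup>1\<^sup>/\<^sup>2)\<close> satisfying step \<open>n\<close> of the scheme together with the normalisation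
  of the pressure; \<open>f n\<close> is the force at the half step between \<open>n\<close> and \<open>n + 1\<close>.
  Only \<open>U n\<close>, and for the second scheme \<open>U (n - 1)\<close>, are used from the sequence \<open>U\<close>.
\<close>

definition CN1_solutions ::
  "nat \<Rightarrow> nat \<Rightarrow> real \<Rightarrow> real \<Rightarrow> real \<Rightarrow> real \<Rightarrow> (mat_pair \<Rightarrow> mat_pair) \<Rightarrow>
   (nat \<Rightarrow> mat_pair) \<Rightarrow> (nat \<Rightarrow> mat_pair) \<Rightarrow> nat \<Rightarrow> (mat_pair \<times> real mat) set" where
  "CN1_solutions Nx Ny hx hy \<tau> \<nu> F f U n =
     {(U1, P). U1 \<in> velocity_space Nx Ny \<and> P \<in> grid_space Nx Ny
        \<and> inner_h hx hy P (ones_mat Nx Ny) = 0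
        \<and> CN_step Nx Ny hx hy \<tau> \<nu> F (f n) (U n) (U n) U1 P}"

definition CN2_solutions ::
  "nat \<Rightarrow> nat \<Rightarrow> real \<Rightarrow> real \<Rightarrow> real \<Rightarrow> real \<Rightarrow> (mat_pair \<Rightarrow> mat_pair) \<Rightarrow>
   (nat \<Rightarrow> mat_pair) \<Rightarrow> (nat \<Rightarrow> mat_pair) \<Rightarrow> nat \<Rightarrow> (mat_pair \<times> real mat) set" where
  "CN2_solutions Nx Ny hx hy \<tau> \<nu> F f U n =
     {(U1, P). U1 \<in> velocity_space Nx Ny \<and> P \<in> grid_space Nx Ny
        \<and> inner_h hx hy P (ones_mat Nx Ny) = 0
        \<and> CN_step Nx Ny hx hy \<tau> \<nu> F (f n) ((1 / 2) \<cdot>\<^sub>p (3 \<cdot>\<^sub>p U n - U (n - 1))) (U n) U1 P}"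

text \<open>
  \<open>U 0, \<dots>, U n\<close> are velocities computed by the respective scheme from the initial value \<open>U0\<close>,
  each step with some admissible pressure.
\<close>

definition CN1_computed ::
  "nat \<Rightarrow> nat \<Rightarrow> real \<Rightarrow> real \<Rightarrow> real \<Rightarrow> real \<Rightarrow> (mat_pair \<Rightarrow> mat_pair) \<Rightarrow>
   (nat \<Rightarrow> mat_pair) \<Rightarrow> mat_pair \<Rightarrow> (nat \<Rightarrow> mat_pair) \<Rightarrow> nat \<Rightarrow> bool" where
  "CN1_computed Nx Ny hx hy \<tau> \<nu> F f U0 U n \<longleftrightarrow>
     U 0 = U0
     \<and> (\<forall>m<n. \<exists>P. (U (Suc m), P) \<in> CN1_solutions Nx Ny hx hy \<tau> \<nu> F f U m)"

definition CN2_computed ::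
  "nat \<Rightarrow> nat \<Rightarrow> real \<Rightarrow> real \<Rightarrow> real \<Rightarrow> real \<Rightarrow> (mat_pair \<Rightarrow> mat_pair) \<Rightarrow>
   (nat \<Rightarrow> mat_pair) \<Rightarrow> mat_pair \<Rightarrow> (nat \<Rightarrow> mat_pair) \<Rightarrow> nat \<Rightarrow> bool" where
  "CN2_computed Nx Ny hx hy \<tau> \<nu> F f U0 U n \<longleftrightarrow>
     U 0 = U0
     \<and> (\<exists>P. (U 1, P) \<in> CN1_solutions Nx Ny hx hy \<tau> \<nu> F f U 0)
     \<and> (\<forall>m\<in>{1..<n}. \<exists>P. (U (Suc m), P) \<in> CN2_solutions Nx Ny hx hy \<tau> \<nu> F f U m)"

end

theory Submission
  imports Defs "Jordan_Normal_Form.Determinant"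
begin

text \<open>
  The operator \<open>B\<close> is nonlinear only in its first argument, which at each step is a known velocity
  \<open>A\<close>. Hence a step is a linear problem for the half-step velocity \<open>W = (U\<^sup>n + U\<^sup>n\<^sup>+\<^sup>1) / 2\<close> and the
  pressure \<open>P\<close>, and for a square linear problem it is enough to show that the homogeneous equations
  have only the zero solution.
  
  The homogeneous problem is settled by the energy method. Take the inner product of the momentum
  equation with \<open>W\<close>. The term with \<open>B\<close> vanishes because \<open>B(A, \<cdot>)\<close> is skew (\<open>op_B_skew\<close>). The pressure
  term vanishes because the discrete gradient is minus the adjoint of the discrete divergence and \<open>W\<close>
  has divergence zero (\<open>grad_adjoint_div\<close>). The viscous term is nonnegative because the second
  difference matrix is \<open>- D\<^sup>T D\<close> with the forward difference matrix \<open>D\<close> (\<open>mat_D3_eq\<close>,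
  \<open>laplace_nonpos\<close>). There remains \<open>2 / \<tau> \<parallel>W\<parallel>\<^sup>2 \<le> 0\<close>, so \<open>W = 0\<close>. Then \<open>P\<close> has zero
  gradient, hence is constant, hence is zero by the normalisation (\<open>grad_kernel\<close>).
  
  As they stand, the equations are not square: there is one more scalar equation than there are
  unknowns, because of the normalisation of the pressure, and the continuity equations are dependent,
  because every discrete divergence has mean zero. Replacing \<open>div W = 0\<close> and \<open>(P, 1) = 0\<close> by the single
  grid equation \<open>div W + (P, 1) 1 = 0\<close> makes the system square, and this equation is equivalent to the
  two, since its two summands are orthogonal (\<open>continuity_and_mean_decouple\<close>). Passing to coordinates,
  a determinant argument gives existence (\<open>linear_state_equation_unique_solution\<close>).
\<close>

section \<open>Square linear systems over a finite index set\<close>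

text \<open>
  Uniqueness for the homogeneous system gives existence for every right-hand side, because the
  system is square: numbering \<open>I\<close> turns \<open>L\<close> into a square matrix, a trivial kernel makes its
  determinant nonzero, and so the matrix has an inverse. The coordinates are indexed by an arbitrary
  finite set so that grid points can be used directly as indices. The assumption \<open>local\<close> makes \<open>L\<close> an
  operator on such coordinate vectors: a function on the whole index type also has values outside \<open>I\<close>.
\<close>

lemma linear_system_solvable:
  fixes L :: "('i \<Rightarrow> 'a::field) \<Rightarrow> 'i \<Rightarrow> 'a"
  assumes fin: "finite I"
    and add: "\<And>x y i. i \<in> I \<Longrightarrow> L (\<lambda>k. x k + y k) i = L x i + L y i"
    and scale: "\<And>c x i. i \<in> I \<Longrightarrow> L (\<lambda>k. c * x k) i = c * L x i"
    and local: "\<And>x y i. (\<And>k. k \<in> I \<Longrightarrow> x k = y k) \<Longrightarrow> i \<in> I \<Longrightarrow> L x i = L y i"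
    and ker: "\<And>x k. (\<And>i. i \<in> I \<Longrightarrow> L x i = 0) \<Longrightarrow> k \<in> I \<Longrightarrow> x k = 0"
  obtains x where "\<And>i. i \<in> I \<Longrightarrow> L x i = b i"
proof -
  define n where "n = card I"
  define a where "a i j = L (\<lambda>k. if k = j then 1 else 0) i" for i j
  \<comment> \<open>Building \<open>x\<close> up one coordinate at a time shows that \<open>L\<close> is given by its values on unit vectors.\<close>
  have expand: "L (\<lambda>k. if k \<in> J then x k else 0) i = (\<Sum>j\<in>J. x j * a i j)"
    if "finite J" "i \<in> I" for x J i
    using that(1)
  proof (induction J)
    case empty
    show ?case using scale[OF that(2), of 0 "\<lambda>k. 0"] by simp
  next
    case (insert j J)
    have "L (\<lambda>k. if k \<in> insert j J then x k else 0) i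
        = L (\<lambda>k. x j * (if k = j then 1 else 0) + (if k \<in> J then x k else 0)) i"
      using insert.hyps by (intro arg_cong[where f = "\<lambda>x. L x i"]) auto
    then show ?case
      using insert by (simp only: add[OF that(2)] scale[OF that(2)] a_def) simp
  qed
  have L_sum: "L x i = (\<Sum>j\<in>I. x j * a i j)" if "i \<in> I" for x i
    using expand[OF fin that] local[OF _ that, of x "\<lambda>k. if k \<in> I then x k else 0"] by simp
  obtain e where e: "bij_betw e {0..<n} I"
    using ex_bij_betw_nat_finite[OF fin] unfolding n_def by blast
  define e' where "e' = inv_into {0..<n} e"
  have e_in: "e r \<in> I" if "r < n" for r
    using e that by (auto simp: bij_betw_def)
  have e'_in: "e' i < n" "e (e' i) = i" if "i \<in> I" for i
    using bij_betw_inv_into_right[OF e that] bij_betw_apply[OF bij_betw_inv_into[OF e] that]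
    unfolding e'_def by auto
  have e'_e: "e' (e r) = r" if "r < n" for r
    using bij_betw_inv_into_left[OF e] that unfolding e'_def by simp
  define M where "M = mat n n (\<lambda>(r, s). a (e r) (e s))"
  have M: "M \<in> carrier_mat n n" by (simp add: M_def)
  have action: "(M *\<^sub>v v) $ r = L (\<lambda>k. v $ e' k) (e r)" if "v \<in> carrier_vec n" "r < n" for v r
  proof -
    have "(M *\<^sub>v v) $ r = (\<Sum>s\<in>{0..<n}. v $ e' (e s) * a (e r) (e s))"
      using that by (auto simp: M_def scalar_prod_def e'_e mult.commute intro!: sum.cong)
    also have "\<dots> = (\<Sum>j\<in>I. v $ e' j * a (e r) j)"
      by (rule sum.reindex_bij_betw[OF e])
    finally show ?thesis using L_sum[OF e_in[OF that(2)]] by simp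
  qed
  have "det M \<noteq> 0"
  proof
    assume "det M = 0"
    then obtain v where v: "v \<in> carrier_vec n" "v \<noteq> 0\<^sub>v n" "M *\<^sub>v v = 0\<^sub>v n"
      using det_0_iff_vec_prod_zero_field[OF M] by blast
    have "L (\<lambda>k. v $ e' k) i = 0" if "i \<in> I" for i
      using action[OF v(1) e'_in(1)[OF that]] e'_in[OF that] v(3) by simp
    then have "v $ e' k = 0" if "k \<in> I" for k
      using ker[of "\<lambda>k. v $ e' k"] that by blast
    then have "v $ r = 0" if "r < n" for r
      using e_in[OF that] e'_e[OF that] by metis
    then show False using v(1,2) by auto
  qed
  then obtain N where N: "N \<in> carrier_mat n n" "M * N = 1\<^sub>m n"
    using det_non_zero_imp_unit[OF M, of "()"]
    by (auto simp: Units_def ring_mat_def)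
  define v where "v = N *\<^sub>v vec n (\<lambda>r. b (e r))"
  have v: "v \<in> carrier_vec n" using N by (simp add: v_def)
  have "M *\<^sub>v v = vec n (\<lambda>r. b (e r))"
    unfolding v_def using M N by (simp flip: assoc_mult_mat_vec[OF M N(1)])
  then have "L (\<lambda>k. v $ e' k) i = b i" if "i \<in> I" for i
    using action[OF v e'_in(1)[OF that]] e'_in[OF that] by simp
  then show ?thesis by (rule that)
qed

section \<open>Triples of two velocity components and a pressure\<close>

lemma smult_pair_simps [simp]: "fst (c \<cdot>\<^sub>p U) = c \<cdot>\<^sub>m fst U" "snd (c \<cdot>\<^sub>p U) = c \<cdot>\<^sub>m snd U"
  by (simp_all add: smult_pair_def)

definition state_space :: "nat \<Rightarrow> nat \<Rightarrow> (mat_pair \<times> real mat) set" where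
  "state_space Nx Ny = velocity_space Nx Ny \<times> grid_space Nx Ny"

definition smult_state :: "real \<Rightarrow> mat_pair \<times> real mat \<Rightarrow> mat_pair \<times> real mat" where
  "smult_state c Z = (c \<cdot>\<^sub>p fst Z, c \<cdot>\<^sub>m snd Z)"

definition zero_state :: "nat \<Rightarrow> nat \<Rightarrow> mat_pair \<times> real mat" where
  "zero_state Nx Ny = (zero_pair Nx Ny, 0\<^sub>m Nx Ny)"

text \<open>
  The first index component selects one of the two velocity components (\<open>0\<close>, \<open>1\<close>) or the pressure
  (\<open>2\<close>); the other two locate the grid point. Outside \<^term>\<open>coord_set Nx Ny\<close> the values are
  meaningless.
\<close>

fun coord :: "mat_pair \<times> real mat \<Rightarrow> nat \<times> nat \<times> nat \<Rightarrow> real" where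
  "coord ((U, V), P) (k, ij) = (if k = 0 then U else if k = 1 then V else P) $$ ij"

definition of_coord :: "nat \<Rightarrow> nat \<Rightarrow> (nat \<times> nat \<times> nat \<Rightarrow> real) \<Rightarrow> mat_pair \<times> real mat" where
  "of_coord Nx Ny x =
     ((mat Nx Ny (\<lambda>ij. x (0, ij)), mat Nx Ny (\<lambda>ij. x (1, ij))), mat Nx Ny (\<lambda>ij. x (2, ij)))"

definition coord_set :: "nat \<Rightarrow> nat \<Rightarrow> (nat \<times> nat \<times> nat) set" where
  "coord_set Nx Ny = {0, 1, 2} \<times> {..<Nx} \<times> {..<Ny}"

lemma state_eqI:
  assumes "Y \<in> state_space Nx Ny" "Z \<in> state_space Nx Ny"
    and "\<And>i. i \<in> coord_set Nx Ny \<Longrightarrow> coord Y i = coord Z i"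
  shows "Y = Z"
proof -
  obtain U V P U' V' P' where [simp]: "Y = ((U, V), P)" "Z = ((U', V'), P')"
    by (metis surj_pair)
  have "U $$ (i, j) = U' $$ (i, j) \<and> V $$ (i, j) = V' $$ (i, j) \<and> P $$ (i, j) = P' $$ (i, j)"
    if "i < Nx" "j < Ny" for i j
    using assms(3)[of "(0, i, j)"] assms(3)[of "(1, i, j)"] assms(3)[of "(2, i, j)"] that
    by (simp add: coord_set_def)
  then show ?thesis
    using assms(1,2) by (auto simp: state_space_def velocity_space_def intro!: eq_matI)
qed

lemma of_coord_in_state_space [simp]: "of_coord Nx Ny x \<in> state_space Nx Ny"
  by (simp add: of_coord_def state_space_def velocity_space_def)

lemma coord_of_coord [simp]: "i \<in> coord_set Nx Ny \<Longrightarrow> coord (of_coord Nx Ny x) i = x i"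
  by (auto simp: coord_set_def of_coord_def)

lemma of_coord_cong:
  "(\<And>i. i \<in> coord_set Nx Ny \<Longrightarrow> x i = y i) \<Longrightarrow> of_coord Nx Ny x = of_coord Nx Ny y"
  by (rule state_eqI[of _ Nx Ny]) auto

lemma add_state_closed:
  "Y \<in> state_space Nx Ny \<Longrightarrow> Z \<in> state_space Nx Ny \<Longrightarrow> Y + Z \<in> state_space Nx Ny"
  by (auto simp: state_space_def velocity_space_def)

lemma smult_state_closed: "Z \<in> state_space Nx Ny \<Longrightarrow> smult_state c Z \<in> state_space Nx Ny"
  by (auto simp: state_space_def velocity_space_def smult_state_def smult_pair_def)

lemma coord_add:
  assumes "Y \<in> state_space Nx Ny" "Z \<in> state_space Nx Ny" "i \<in> coord_set Nx Ny"
  shows "coord (Y + Z) i = coord Y i + coord Z i"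
  using assms by (auto simp: state_space_def velocity_space_def coord_set_def)

lemma coord_smult:
  assumes "Z \<in> state_space Nx Ny" "i \<in> coord_set Nx Ny"
  shows "coord (smult_state c Z) i = c * coord Z i"
  using assms
  by (auto simp: state_space_def velocity_space_def coord_set_def smult_state_def smult_pair_def)

text \<open>
  The number of unknowns and the number of equations are both \<open>3 Nx Ny\<close>, so in coordinates this is
  a square system, to which \<open>linear_system_solvable\<close> applies.
\<close>

lemma linear_state_equation_unique_solution:
  assumes map: "T \<in> state_space Nx Ny \<rightarrow> state_space Nx Ny"
    and add: "\<And>Y Z. Y \<in> state_space Nx Ny \<Longrightarrow> Z \<in> state_space Nx Ny \<Longrightarrow> T (Y + Z) = T Y + T Z"
    and scale: "\<And>c Z. Z \<in> state_space Nx Ny \<Longrightarrow> T (smult_state c Z) = smult_state c (T Z)"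
    and ker: "\<And>Z. Z \<in> state_space Nx Ny \<Longrightarrow> T Z = zero_state Nx Ny \<Longrightarrow> Z = zero_state Nx Ny"
    and R: "R \<in> state_space Nx Ny"
  shows "\<exists>!Z. Z \<in> state_space Nx Ny \<and> T Z = R"
proof -
  let ?S = "state_space Nx Ny" and ?I = "coord_set Nx Ny" and ?of = "of_coord Nx Ny"
  have TZ: "T Z \<in> ?S" if "Z \<in> ?S" for Z using map that by blast
  have zero: "zero_state Nx Ny \<in> ?S" "\<And>i. i \<in> ?I \<Longrightarrow> coord (zero_state Nx Ny) i = 0"
    by (auto simp: zero_state_def zero_pair_def state_space_def velocity_space_def coord_set_def)
  have of_add: "?of (\<lambda>k. x k + y k) = ?of x + ?of y" for x y :: "nat \<times> nat \<times> nat \<Rightarrow> real"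
    by (rule state_eqI[of _ Nx Ny]) (auto simp: add_state_closed coord_add[of _ Nx Ny])
  have of_scale: "?of (\<lambda>k. c * x k) = smult_state c (?of x)" for c and x :: "nat \<times> nat \<times> nat \<Rightarrow> real"
    by (rule state_eqI[of _ Nx Ny]) (auto simp: smult_state_closed coord_smult[of _ Nx Ny])
  have "\<exists>Z. Z \<in> ?S \<and> T Z = R"
  proof -
    obtain x where x: "\<And>i. i \<in> ?I \<Longrightarrow> coord (T (?of x)) i = coord R i"
    proof (rule linear_system_solvable[where I = ?I and L = "\<lambda>x. coord (T (?of x))" and b = "coord R"])
      show "finite ?I" by (simp add: coord_set_def)
    next
      fix x y :: "nat \<times> nat \<times> nat \<Rightarrow> real" and i assume "i \<in> ?I"
      then show "coord (T (?of (\<lambda>k. x k + y k))) i = coord (T (?of x)) i + coord (T (?of y)) i"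
        by (simp add: of_add add coord_add[of _ Nx Ny] TZ)
    next
      fix c and x :: "nat \<times> nat \<times> nat \<Rightarrow> real" and i assume "i \<in> ?I"
      then show "coord (T (?of (\<lambda>k. c * x k))) i = c * coord (T (?of x)) i"
        by (simp add: of_scale scale coord_smult[of _ Nx Ny] TZ)
    next
      fix x y :: "nat \<times> nat \<times> nat \<Rightarrow> real" and i
      assume "\<And>k. k \<in> ?I \<Longrightarrow> x k = y k"
      then show "coord (T (?of x)) i = coord (T (?of y)) i"
        using of_coord_cong by metis
    next
      fix x :: "nat \<times> nat \<times> nat \<Rightarrow> real" and k
      assume "\<And>i. i \<in> ?I \<Longrightarrow> coord (T (?of x)) i = 0" and k: "k \<in> ?I"
      then have "T (?of x) = zero_state Nx Ny"
        by (intro state_eqI[of _ Nx Ny]) (auto simp: TZ zero)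
      then have "?of x = zero_state Nx Ny" by (intro ker[OF of_coord_in_state_space])
      then show "x k = 0" using coord_of_coord[OF k, of x] zero(2)[OF k] by simp
    qed blast
    then have "T (?of x) = R" by (intro state_eqI[of _ Nx Ny]) (auto simp: TZ R)
    then show ?thesis by (intro exI[of _ "?of x"]) simp
  qed
  moreover have "Y = Z" if Y: "Y \<in> ?S" "T Y = R" and Z: "Z \<in> ?S" "T Z = R" for Y Z
  proof -
    let ?D = "Y + smult_state (-1) Z"
    have D: "?D \<in> ?S" using Y Z by (simp add: add_state_closed smult_state_closed)
    have "T ?D = R + smult_state (-1) R"
      using Y Z by (simp add: add scale add_state_closed smult_state_closed)
    also have "\<dots> = zero_state Nx Ny"
      by (rule state_eqI[of _ Nx Ny])
        (auto simp: R zero add_state_closed smult_state_closed coord_add[of _ Nx Ny] coord_smult[of _ Nx Ny])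
    finally have "?D = zero_state Nx Ny" by (rule ker[OF D])
    then have "coord Y i = coord Z i" if "i \<in> ?I" for i
      using zero(2)[OF that] coord_add[OF Y(1) smult_state_closed[OF Z(1)] that, of "-1"]
        coord_smult[OF Z(1) that, of "-1"] by simp
    then show ?thesis using Y(1) Z(1) by (rule state_eqI[rotated 2])
  qed
  ultimately show ?thesis by blast
qed

section \<open>The discrete inner product\<close>

lemma inner_h_eq_sum:
  assumes "A \<in> carrier_mat N M" "B \<in> carrier_mat N M"
  shows "inner_h hx hy A B = hx * hy * (\<Sum>i<N. \<Sum>j<M. A $$ (i, j) * B $$ (i, j))"
proof -
  have "mat_trace (transpose_mat A * B) = (\<Sum>j<M. \<Sum>i<N. A $$ (i, j) * B $$ (i, j))"
    using assms
    by (auto simp: mat_trace_def scalar_prod_def atLeast0LessThan intro!: sum.cong)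
  then show ?thesis unfolding inner_h_def by (simp only: sum.swap[of _ "{..<N}"])
qed

lemma inner_h_commute:
  assumes "A \<in> carrier_mat N M" "B \<in> carrier_mat N M"
  shows "inner_h hx hy A B = inner_h hx hy B A"
  using assms by (simp add: inner_h_eq_sum[of _ N M] mult.commute)

lemma inner_h_linear:
  assumes "A \<in> carrier_mat N M" "B \<in> carrier_mat N M" "C \<in> carrier_mat N M"
  shows "inner_h hx hy (A + B) C = inner_h hx hy A C + inner_h hx hy B C"
    and "inner_h hx hy (A - B) C = inner_h hx hy A C - inner_h hx hy B C"
    and "inner_h hx hy (c \<cdot>\<^sub>m A) C = c * inner_h hx hy A C"
    and "inner_h hx hy (- A) C = - inner_h hx hy A C"
    and "inner_h hx hy A (B + C) = inner_h hx hy A B + inner_h hx hy A C"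
    and "inner_h hx hy A (c \<cdot>\<^sub>m B) = c * inner_h hx hy A B"
  using assms minus_carrier_mat[OF assms(2), of A]
  by (simp_all add: inner_h_eq_sum[of _ N M] algebra_simps sum.distrib sum_subtractf
        sum_distrib_left sum_negf)

lemma inner_h_zero_left: "C \<in> carrier_mat N M \<Longrightarrow> inner_h hx hy (0\<^sub>m N M) C = 0"
  by (simp add: inner_h_eq_sum[of _ N M])

lemma inner_h_transpose:
  assumes "A \<in> carrier_mat N M" "B \<in> carrier_mat N M"
  shows "inner_h hx hy (transpose_mat A) (transpose_mat B) = inner_h hx hy A B"
proof -
  have "inner_h hx hy (transpose_mat A) (transpose_mat B)
      = hx * hy * (\<Sum>j<M. \<Sum>i<N. A $$ (i, j) * B $$ (i, j))"
    using assms by (simp add: inner_h_eq_sum[of _ M N])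
  then show ?thesis using assms by (simp only: sum.swap[of _ "{..<M}"] inner_h_eq_sum)
qed

lemma inner_h_adjoint_left:
  assumes "K \<in> carrier_mat N N'" "X \<in> carrier_mat N M" "Y \<in> carrier_mat N' M"
  shows "inner_h hx hy (transpose_mat K * X) Y = inner_h hx hy X (K * Y)"
proof -
  have "transpose_mat (transpose_mat K * X) * Y = transpose_mat X * (K * Y)"
    using assms by (simp add: transpose_mult[of _ N' N _ M] assoc_mult_mat[of _ M N _ N' _ M])
  then show ?thesis by (simp add: inner_h_def)
qed

text \<open>
  Transposing everything turns multiplication from the right into multiplication from the left.
\<close>

lemma inner_h_adjoint_right:
  assumes "K \<in> carrier_mat M M'" "X \<in> carrier_mat N M" "Y \<in> carrier_mat N M'"
  shows "inner_h hx hy (X * K) Y = inner_h hx hy X (Y * transpose_mat K)"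
proof -
  have "inner_h hx hy (X * K) Y = inner_h hx hy (transpose_mat K * transpose_mat X) (transpose_mat Y)"
    using assms by (simp add: inner_h_transpose[of _ N M', symmetric] transpose_mult[of _ N M _ M'])
  also have "\<dots> = inner_h hx hy (transpose_mat X) (K * transpose_mat Y)"
    using assms by (intro inner_h_adjoint_left) auto
  also have "\<dots> = inner_h hx hy X (Y * transpose_mat K)"
    using assms by (simp add: inner_h_transpose[of _ N M, symmetric] transpose_mult[of _ N M' _ M])
  finally show ?thesis .
qed

lemma inner_h_nonneg:
  assumes "A \<in> carrier_mat N M" "hx > 0" "hy > 0"
  shows "inner_h hx hy A A \<ge> 0"
  using assms by (simp add: inner_h_eq_sum[of _ N M] sum_nonneg)

lemma inner_h_definite:
  assumes A: "A \<in> carrier_mat N M" and h: "hx > 0" "hy > 0" and 0: "inner_h hx hy A A = 0"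
  shows "A = 0\<^sub>m N M"
proof (rule eq_matI)
  fix i j assume "i < dim_row (0\<^sub>m N M)" "j < dim_col (0\<^sub>m N M)"
  then have ij: "i < N" "j < M" by auto
  have "(\<Sum>i<N. \<Sum>j<M. A $$ (i, j) * A $$ (i, j)) = 0"
    using 0 h by (simp add: inner_h_eq_sum[OF A A])
  then have "(\<Sum>j<M. A $$ (i, j) * A $$ (i, j)) = 0"
    using ij by (subst (asm) sum_nonneg_eq_0_iff) (auto intro: sum_nonneg)
  then have "A $$ (i, j) * A $$ (i, j) = 0"
    using ij by (subst (asm) sum_nonneg_eq_0_iff) auto
  then show "A $$ (i, j) = 0\<^sub>m N M $$ (i, j)" using ij by simp
qed (use A in auto)

section \<open>Periodic difference matrices\<close>

lemma mat_carriers [simp]: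
  "mat_C N \<in> carrier_mat N N" "mat_D1 N h \<in> carrier_mat N N"
  "mat_D2 N h \<in> carrier_mat N N" "mat_D3 N h \<in> carrier_mat N N"
  by (simp_all add: mat_C_def mat_D1_def mat_D2_def mat_D3_def)

lemma mat_dims [simp]:
  "dim_row (mat_C N) = N" "dim_col (mat_C N) = N"
  "dim_row (mat_D1 N h) = N" "dim_col (mat_D1 N h) = N"
  "dim_row (mat_D2 N h) = N" "dim_col (mat_D2 N h) = N"
  "dim_row (mat_D3 N h) = N" "dim_col (mat_D3 N h) = N"
  by (simp_all add: mat_C_def mat_D1_def mat_D2_def mat_D3_def)

lemma cyclic_succ_eq_iff_pred:
  fixes i k N :: nat
  assumes "i < N" "k < N"
  shows "i = (k + 1) mod N \<longleftrightarrow> k = (i + N - 1) mod N"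
proof (cases "k + 1 = N")
  case True
  with assms show ?thesis by (cases "i = 0") (auto simp: mod_if)
next
  case False
  with assms show ?thesis by (cases "i = 0") (auto simp: mod_if)
qed

lemma transpose_mat_D2_mult:
  assumes P: "P \<in> carrier_mat N M" and i: "i < N" and j: "j < M"
  shows "(transpose_mat (mat_D2 N h) * P) $$ (i, j)
    = 1 / h * (P $$ ((i + N - 1) mod N, j) - P $$ (i, j))"
proof -
  have "(transpose_mat (mat_D2 N h) * P) $$ (i, j) = (\<Sum>k = 0..<N. 1 / h *
      (of_bool (k = (i + N - 1) mod N) * P $$ (k, j) - of_bool (k = i) * P $$ (k, j)))"
    using P i j cyclic_succ_eq_iff_pred[OF i]
    by (auto simp: scalar_prod_def mat_D2_def algebra_simps intro!: sum.cong)
  also have "\<dots> = 1 / h * (P $$ ((i + N - 1) mod N, j) - P $$ (i, j))"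
    using i by (simp only: sum_distrib_left [symmetric] sum_subtractf) (simp add: sum_of_bool_index)
  finally show ?thesis .
qed

text \<open>
  If \<open>S\<close> is the cyclic shift, then the forward difference is \<open>(S - 1) / h\<close>, its transpose is
  \<open>(S\<^sup>-\<^sup>1 - 1) / h\<close>, and minus their product is \<open>(S - 2 + S\<^sup>-\<^sup>1) / h\<^sup>2\<close>. This factorisation is
  discrete integration by parts for the Laplacian. It holds also for \<open>N = 1\<close> and \<open>N = 2\<close>, where
  neighbours coincide.
\<close>

lemma mat_D3_eq: "mat_D3 N h = - (transpose_mat (mat_D2 N h) * mat_D2 N h)"
proof (rule eq_matI)
  fix i k assume "i < dim_row (- (transpose_mat (mat_D2 N h) * mat_D2 N h))"
    "k < dim_col (- (transpose_mat (mat_D2 N h) * mat_D2 N h))"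
  then have ik: "i < N" "k < N" by auto
  then have p: "(i + N - 1) mod N < N" by auto
  have "((i + N - 1) mod N + 1) mod N = i"
    using cyclic_succ_eq_iff_pred[OF ik(1) p] by simp
  then show "mat_D3 N h $$ (i, k) = (- (transpose_mat (mat_D2 N h) * mat_D2 N h)) $$ (i, k)"
    using ik p by (simp del: index_mult_mat(1)
        add: index_mult_mat(2,3) transpose_mat_D2_mult[where M = N])
      (simp add: mat_D2_def mat_D3_def power2_eq_square field_simps)
qed auto

lemma mat_D3_nonpos:
  assumes X: "X \<in> carrier_mat N M" and h: "hx > 0" "hy > 0"
  shows "inner_h hx hy (mat_D3 N h * X) X \<le> 0"
proof -
  let ?D = "mat_D2 N h"
  have DX: "?D * X \<in> carrier_mat N M" by (rule mult_carrier_mat[OF mat_carriers(3) X])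
  have "mat_D3 N h * X = - (transpose_mat ?D * (?D * X))"
    using X by (simp add: mat_D3_eq assoc_mult_mat[of _ N N _ N _ M] uminus_mult_left_mat)
  moreover have "transpose_mat ?D * (?D * X) \<in> carrier_mat N M"
    by (rule mult_carrier_mat[OF _ DX]) simp
  ultimately have "inner_h hx hy (mat_D3 N h * X) X = - inner_h hx hy (?D * X) (?D * X)"
    using X DX by (simp add: inner_h_linear(4)[of _ N M] inner_h_adjoint_left[of _ N N _ M])
  then show ?thesis using inner_h_nonneg[OF DX h] by simp
qed

text \<open>
  A vanishing backward difference makes each entry equal to its predecessor, hence to entry \<open>0\<close>.
\<close>

lemma transpose_mat_D2_kernel:
  assumes P: "P \<in> carrier_mat N M" and h: "h \<noteq> 0" and 0: "transpose_mat (mat_D2 N h) * P = 0\<^sub>m N M"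
    and i: "i < N" and j: "j < M"
  shows "P $$ (i, j) = P $$ (0, j)"
  using i
proof (induction i)
  case (Suc i)
  have "P $$ ((Suc i + N - 1) mod N, j) = P $$ (Suc i, j)"
    using transpose_mat_D2_mult[OF P Suc.prems j, of h] Suc.prems j h by (simp add: 0)
  then show ?case using Suc by simp
qed simp

lemma transpose_mat_D2_ones: "transpose_mat (mat_D2 N h) * ones_mat N M = 0\<^sub>m N M"
proof (rule eq_matI)
  fix i j assume "i < dim_row (0\<^sub>m N M)" "j < dim_col (0\<^sub>m N M)"
  then show "(transpose_mat (mat_D2 N h) * ones_mat N M) $$ (i, j) = 0\<^sub>m N M $$ (i, j)"
    by (subst transpose_mat_D2_mult[where M = M]) (auto simp: ones_mat_def)
qed (auto simp: ones_mat_def)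

section \<open>Discrete integration by parts\<close>

lemma uminus_eq_zero_mat:
  fixes X :: "real mat"
  assumes "X \<in> carrier_mat n m" "- X = 0\<^sub>m n m"
  shows "X = 0\<^sub>m n m"
proof (rule eq_matI)
  fix i j assume "i < dim_row (0\<^sub>m n m)" "j < dim_col (0\<^sub>m n m)"
  then show "X $$ (i, j) = 0\<^sub>m n m $$ (i, j)"
    using assms(1) arg_cong[OF assms(2), of "\<lambda>Y. Y $$ (i, j)"] by simp
qed (use assms in auto)

locale staggered_grid =
  fixes Nx Ny :: nat and hx hy :: real
  assumes positive: "Nx > 0" "Ny > 0" "hx > 0" "hy > 0"
begin

abbreviation "velocities \<equiv> velocity_space Nx Ny"
abbreviation "ip \<equiv> inner_pair_h hx hy"
abbreviation "div_h \<equiv> div_d Nx Ny hx hy"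
abbreviation "grad_h \<equiv> grad_D Nx Ny hx hy"
abbreviation "ones \<equiv> ones_mat Nx Ny"

lemma ones_carrier [simp]: "ones \<in> grid_space Nx Ny"
  by (simp add: ones_mat_def)

lemma velocity_closed:
  assumes "U \<in> velocities" "W \<in> velocities"
  shows "U + W \<in> velocities" "U - W \<in> velocities"
  using assms by (auto simp: velocity_space_def intro: minus_carrier_mat)

lemma smult_velocity_closed: "U \<in> velocities \<Longrightarrow> c \<cdot>\<^sub>p U \<in> velocities"
  by (auto simp: velocity_space_def smult_pair_def)

lemma grid_mult_closed [simp]:
  "K \<in> carrier_mat Nx Nx \<Longrightarrow> X \<in> grid_space Nx Ny \<Longrightarrow> K * X \<in> grid_space Nx Ny"
  "X \<in> grid_space Nx Ny \<Longrightarrow> M \<in> carrier_mat Ny Ny \<Longrightarrow> X * M \<in> grid_space Nx Ny"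
  by (rule mult_carrier_mat, assumption+)+

lemma div_closed: "U \<in> velocities \<Longrightarrow> div_h U \<in> grid_space Nx Ny"
  by (auto simp: velocity_space_def div_d_def)

lemma grad_closed: "P \<in> grid_space Nx Ny \<Longrightarrow> grad_h P \<in> velocities"
  by (auto simp: velocity_space_def grad_D_def)

lemma laplace_closed: "U \<in> velocities \<Longrightarrow> laplace_pair_h Nx Ny hx hy U \<in> velocities"
  by (auto simp: velocity_space_def laplace_pair_h_def laplace_h_def)

lemma op_G_closed:
  assumes "A \<in> velocities"
  shows "op_G Nx Ny hx hy F A \<in> velocities"
proof -
  have had: "X \<odot> Y \<in> grid_space Nx Ny" if "X \<in> grid_space Nx Ny" for X Y
    using that by (auto simp: hadamard_def)
  show ?thesis
    using assms
    by (auto simp: op_G_def Let_def smult_pair_def velocity_space_def zero_pair_def had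
        intro!: smult_carrier_mat minus_carrier_mat)
qed

lemma op_B_closed:
  assumes "A \<in> velocities" "F A \<in> velocities"
  shows "op_B Nx Ny hx hy F A W \<in> velocities"
  unfolding op_B_def
  by (intro velocity_closed smult_velocity_closed op_G_closed assms)

lemma ip_add:
  assumes "U \<in> velocities" "V \<in> velocities" "W \<in> velocities"
  shows "ip (U + V) W = ip U W + ip V W" "ip (U - V) W = ip U W - ip V W"
    "ip W (U + V) = ip W U + ip W V"
  using assms by (auto simp: velocity_space_def inner_pair_h_def inner_h_linear[of _ Nx Ny])

lemma ip_smult:
  assumes "U \<in> velocities" "W \<in> velocities"
  shows "ip (c \<cdot>\<^sub>p U) W = c * ip U W" "ip W (c \<cdot>\<^sub>p U) = c * ip W U"
  using assms
  by (auto simp: velocity_space_def inner_pair_h_def smult_pair_def inner_h_linear[of _ Nx Ny] algebra_simps)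

lemma ip_definite:
  assumes "U \<in> velocities" "ip U U \<le> 0"
  shows "U = zero_pair Nx Ny"
proof -
  obtain A B where [simp]: "U = (A, B)" and AB: "A \<in> grid_space Nx Ny" "B \<in> grid_space Nx Ny"
    using assms(1) by (auto simp: velocity_space_def)
  have "inner_h hx hy A A = 0" "inner_h hx hy B B = 0"
    using assms(2) inner_h_nonneg[OF AB(1) positive(3,4)] inner_h_nonneg[OF AB(2) positive(3,4)]
    by (auto simp: inner_pair_h_def)
  then show ?thesis
    using inner_h_definite[OF AB(1) positive(3,4)] inner_h_definite[OF AB(2) positive(3,4)]
    by (simp add: zero_pair_def)
qed

text \<open>
  The pressure does no work on discretely divergence-free velocities.
\<close>

lemma grad_adjoint_div:
  assumes P: "P \<in> grid_space Nx Ny" and U: "U \<in> velocities"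
  shows "ip (grad_h P) U = - inner_h hx hy P (div_h U)"
proof -
  obtain A B where [simp]: "U = (A, B)" and AB: "A \<in> grid_space Nx Ny" "B \<in> grid_space Nx Ny"
    using U by (auto simp: velocity_space_def)
  show ?thesis
    using P AB
    by (simp add: inner_pair_h_def grad_D_def div_d_def inner_h_linear[of _ Nx Ny]
        inner_h_adjoint_left[of _ Nx Nx _ Ny] inner_h_adjoint_right[of _ Ny Ny _ Nx])
qed

text \<open>
  Each second difference matrix is \<open>- D\<^sup>T D\<close>, so viscosity dissipates energy. The term with the
  matrix on the right becomes one with the matrix on the left after transposition.
\<close>

lemma laplace_nonpos:
  assumes "U \<in> velocities"
  shows "ip (laplace_pair_h Nx Ny hx hy U) U \<le> 0"
proof -
  have "inner_h hx hy (laplace_h Nx Ny hx hy X) X \<le> 0" if X: "X \<in> grid_space Nx Ny" for X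
  proof -
    have "inner_h hx hy (X * transpose_mat (mat_D3 Ny hy)) X
        = inner_h hx hy (mat_D3 Ny hy * transpose_mat X) (transpose_mat X)"
      using X by (simp add: inner_h_transpose[of _ Nx Ny, symmetric] transpose_mult[of _ Nx Ny _ Ny])
    moreover have "transpose_mat X \<in> carrier_mat Ny Nx" using X by simp
    ultimately show ?thesis
      using X mat_D3_nonpos[OF X positive(3,4), of hx]
        mat_D3_nonpos[of "transpose_mat X" Ny Nx hx hy hy] positive
      by (simp add: laplace_h_def inner_h_linear[of _ Nx Ny])
  qed
  from this[of "fst U"] this[of "snd U"] show ?thesis
    using assms by (auto simp: inner_pair_h_def laplace_pair_h_def velocity_space_def)
qed

text \<open>
  The two terms of \<open>B(A, W)\<close> give \<open>(F(A), W) (G(A), W)\<close> with opposite signs, so the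
  nonlinear term does no work on \<open>W\<close>.
\<close>

lemma op_B_skew:
  assumes "A \<in> velocities" "F A \<in> velocities" "W \<in> velocities"
  shows "ip (op_B Nx Ny hx hy F A W) W = 0"
  using assms unfolding op_B_def
  by (simp add: ip_add ip_smult smult_velocity_closed op_G_closed)

text \<open>
  A pressure with zero gradient is constant in both directions, because the periodic grid is
  connected under the compact differences; a constant of mean zero vanishes.
\<close>

lemma grad_kernel:
  assumes P: "P \<in> grid_space Nx Ny" and grad: "grad_h P = zero_pair Nx Ny"
    and mean: "inner_h hx hy P ones = 0"
  shows "P = 0\<^sub>m Nx Ny"
proof -
  have "transpose_mat (mat_D2 Nx hx) * P = 0\<^sub>m Nx Ny" "P * mat_D2 Ny hy = 0\<^sub>m Nx Ny"
    using grad P by (auto simp: grad_D_def zero_pair_def intro!: uminus_eq_zero_mat)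
  note x = this(1) and y = this(2)
  have "transpose_mat (mat_D2 Ny hy) * transpose_mat P = 0\<^sub>m Ny Nx"
    using y P by (simp flip: transpose_mult[of P Nx Ny _ Ny])
  note y = transpose_mat_D2_kernel[OF _ _ this]
  have const: "P $$ (i, j) = P $$ (0, 0)" if "i < Nx" "j < Ny" for i j
    using transpose_mat_D2_kernel[OF P _ x that] y[of j 0] P that positive by simp
  have entry: "P $$ (i, j) * ones $$ (i, j) = P $$ (0, 0)" if "i < Nx" "j < Ny" for i j
    using const[OF that] that by (simp add: ones_mat_def)
  have "inner_h hx hy P ones = hx * hy * (\<Sum>i<Nx. \<Sum>j<Ny. P $$ (0, 0))"
    unfolding inner_h_eq_sum[OF P ones_carrier] using entry by simp
  then have "P $$ (0, 0) = 0" using mean positive by simp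
  then have "P $$ (i, j) = 0" if "i < Nx" "j < Ny" for i j
    using const[OF that] by simp
  then show ?thesis using P by (intro eq_matI) auto
qed

text \<open>
  By adjointness the mean of a divergence is the pairing of the velocity with the gradient of a constant.
\<close>

lemma div_mean_zero:
  assumes "U \<in> velocities"
  shows "inner_h hx hy (div_h U) ones = 0"
proof -
  have "transpose_mat ones = ones_mat Ny Nx" by (auto simp: ones_mat_def)
  then have "transpose_mat (ones * mat_D2 Ny hy) = 0\<^sub>m Ny Nx"
    by (simp add: transpose_mult[of _ Nx Ny _ Ny] transpose_mat_D2_ones)
  then have "ones * mat_D2 Ny hy = 0\<^sub>m Nx Ny"
    by (metis transpose_transpose zero_transpose_mat)
  then have "grad_h ones = zero_pair Nx Ny"
    by (auto simp: grad_D_def zero_pair_def transpose_mat_D2_ones)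
  then show ?thesis
    using assms grad_adjoint_div[OF ones_carrier assms] inner_h_commute[OF div_closed[OF assms] ones_carrier]
    by (auto simp: inner_pair_h_def zero_pair_def inner_h_zero_left velocity_space_def)
qed

section \<open>The Crank--Nicolson step as a square linear system\<close>

text \<open>
  The momentum equation has this operator acting on the half-step velocity \<open>W = (U\<^sup>n + U\<^sup>n\<^sup>+\<^sup>1) / 2\<close>:
  since \<open>U\<^sup>n\<^sup>+\<^sup>1 - U\<^sup>n = 2 (W - U\<^sup>n)\<close>, the time difference contributes \<open>2 W / \<tau>\<close>, and the remaining
  \<open>2 U\<^sup>n / \<tau>\<close> goes to the right-hand side.
\<close>

definition cn_velocity_op ::
  "real \<Rightarrow> real \<Rightarrow> (mat_pair \<Rightarrow> mat_pair) \<Rightarrow> mat_pair \<Rightarrow> mat_pair \<Rightarrow> mat_pair" where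
  "cn_velocity_op \<tau> \<nu> F A W =
     (2 / \<tau>) \<cdot>\<^sub>p W - \<nu> \<cdot>\<^sub>p laplace_pair_h Nx Ny hx hy W + op_B Nx Ny hx hy F A W"

text \<open>
  Momentum and continuity equations together have a one-dimensional redundancy: divergences have mean
  zero, while the pressure is determined up to a constant. Adding the multiple \<open>(P, 1)\<^sub>h\<close> of the
  all-ones grid function to the divergence uses the redundant equation to normalise the pressure, so that
  no separate equation has to be added and the system is square.
\<close>

definition cn_op ::
  "real \<Rightarrow> real \<Rightarrow> (mat_pair \<Rightarrow> mat_pair) \<Rightarrow> mat_pair \<Rightarrow> mat_pair \<times> real mat \<Rightarrow> mat_pair \<times> real mat"
  where
  "cn_op \<tau> \<nu> F A Z =
     (cn_velocity_op \<tau> \<nu> F A (fst Z) + grad_h (snd Z),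
      div_h (fst Z) + inner_h hx hy (snd Z) ones \<cdot>\<^sub>m ones)"

lemma cn_velocity_op_closed:
  assumes "A \<in> velocities" "F A \<in> velocities" "W \<in> velocities"
  shows "cn_velocity_op \<tau> \<nu> F A W \<in> velocities"
  unfolding cn_velocity_op_def
  by (intro velocity_closed smult_velocity_closed laplace_closed op_B_closed assms)

text \<open>
  The discrete energy estimate: the time difference contributes the positive term, the viscous term
  has a good sign, and \<open>B\<close> drops out.
\<close>

lemma cn_velocity_op_coercive:
  assumes "A \<in> velocities" "F A \<in> velocities" "W \<in> velocities" "\<nu> > 0"
  shows "ip (cn_velocity_op \<tau> \<nu> F A W) W \<ge> 2 / \<tau> * ip W W"
proof -
  have "ip (cn_velocity_op \<tau> \<nu> F A W) W
      = 2 / \<tau> * ip W W - \<nu> * ip (laplace_pair_h Nx Ny hx hy W) W"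
    using assms unfolding cn_velocity_op_def
    by (simp add: ip_add ip_smult velocity_closed smult_velocity_closed laplace_closed op_B_closed op_B_skew)
  moreover have "\<nu> * ip (laplace_pair_h Nx Ny hx hy W) W \<le> 0"
    using laplace_nonpos[OF assms(3)] assms(4) by (simp add: mult_nonneg_nonpos)
  ultimately show ?thesis by simp
qed

lemma velocityD:
  assumes "U \<in> velocities"
  shows "fst U \<in> grid_space Nx Ny" "snd U \<in> grid_space Nx Ny"
    "dim_row (fst U) = Nx" "dim_col (fst U) = Ny" "dim_row (snd U) = Nx" "dim_col (snd U) = Ny"
  using assms by (auto simp: velocity_space_def)

lemma velocity_eqI:
  assumes "U \<in> velocities" "W \<in> velocities"
    and "\<And>i j. i < Nx \<Longrightarrow> j < Ny \<Longrightarrow> fst U $$ (i, j) = fst W $$ (i, j)"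
    and "\<And>i j. i < Nx \<Longrightarrow> j < Ny \<Longrightarrow> snd U $$ (i, j) = snd W $$ (i, j)"
  shows "U = W"
  using assms by (intro prod_eqI eq_matI) (auto simp: velocityD)

lemma grad_linear:
  assumes "P \<in> grid_space Nx Ny" "Q \<in> grid_space Nx Ny"
  shows "grad_h (P + Q) = grad_h P + grad_h Q" "grad_h (c \<cdot>\<^sub>m P) = c \<cdot>\<^sub>p grad_h P"
  using assms
  by (auto simp: grad_D_def smult_pair_def mult_add_distrib_mat[of _ Nx Nx _ Ny]
      add_mult_distrib_mat[of _ Nx Ny _ _ Ny] mult_smult_distrib[of _ Nx Nx _ Ny]
      mult_smult_assoc_mat[of _ Nx Ny _ Ny] simp del: index_mult_mat(1) intro!: eq_matI)

lemma div_linear: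
  assumes "U \<in> velocities" "W \<in> velocities"
  shows "div_h (U + W) = div_h U + div_h W" "div_h (c \<cdot>\<^sub>p U) = c \<cdot>\<^sub>m div_h U"
  using velocityD[OF assms(1)] velocityD[OF assms(2)]
  by (auto simp: div_d_def mult_add_distrib_mat[of _ Nx Nx _ Ny]
      add_mult_distrib_mat[of _ Nx Ny _ _ Ny] mult_smult_distrib[of _ Nx Nx _ Ny]
      mult_smult_assoc_mat[of _ Nx Ny _ Ny] algebra_simps simp del: index_mult_mat(1) intro!: eq_matI)

lemma laplace_h_linear:
  assumes "X \<in> grid_space Nx Ny" "Y \<in> grid_space Nx Ny"
  shows "laplace_h Nx Ny hx hy (X + Y) = laplace_h Nx Ny hx hy X + laplace_h Nx Ny hx hy Y"
    "laplace_h Nx Ny hx hy (c \<cdot>\<^sub>m X) = c \<cdot>\<^sub>m laplace_h Nx Ny hx hy X"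
  using assms
  by (auto simp: laplace_h_def mult_add_distrib_mat[of _ Nx Nx _ Ny]
      add_mult_distrib_mat[of _ Nx Ny _ _ Ny] mult_smult_distrib[of _ Nx Nx _ Ny]
      mult_smult_assoc_mat[of _ Nx Ny _ Ny] algebra_simps simp del: index_mult_mat(1) intro!: eq_matI)

lemma laplace_linear:
  assumes "U \<in> velocities" "W \<in> velocities"
  shows "laplace_pair_h Nx Ny hx hy (U + W) = laplace_pair_h Nx Ny hx hy U + laplace_pair_h Nx Ny hx hy W"
    "laplace_pair_h Nx Ny hx hy (c \<cdot>\<^sub>p U) = c \<cdot>\<^sub>p laplace_pair_h Nx Ny hx hy U"
  using velocityD[OF assms(1)] velocityD[OF assms(2)]
  by (simp_all add: laplace_pair_h_def laplace_h_linear smult_pair_def)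

lemma op_B_linear:
  assumes "A \<in> velocities" "F A \<in> velocities" "U \<in> velocities" "W \<in> velocities"
  shows "op_B Nx Ny hx hy F A (U + W) = op_B Nx Ny hx hy F A U + op_B Nx Ny hx hy F A W"
    "op_B Nx Ny hx hy F A (c \<cdot>\<^sub>p U) = c \<cdot>\<^sub>p op_B Nx Ny hx hy F A U"
  using assms op_G_closed[OF assms(1), of F]
  by (auto intro!: velocity_eqI velocity_closed smult_velocity_closed op_B_closed
      simp: op_B_def ip_add ip_smult velocityD algebra_simps)

lemma cn_velocity_op_linear:
  assumes "A \<in> velocities" "F A \<in> velocities" "U \<in> velocities" "W \<in> velocities"
  shows "cn_velocity_op \<tau> \<nu> F A (U + W) = cn_velocity_op \<tau> \<nu> F A U + cn_velocity_op \<tau> \<nu> F A W"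
    "cn_velocity_op \<tau> \<nu> F A (c \<cdot>\<^sub>p U) = c \<cdot>\<^sub>p cn_velocity_op \<tau> \<nu> F A U"
  using assms op_B_closed[of A F U, OF assms(1,2)] op_B_closed[of A F W, OF assms(1,2)]
    laplace_closed[OF assms(3)] laplace_closed[OF assms(4)]
  unfolding cn_velocity_op_def
  by (auto intro!: velocity_eqI velocity_closed smult_velocity_closed
      simp: laplace_linear op_B_linear velocityD algebra_simps)

lemma cn_op_closed:
  assumes "A \<in> velocities" "F A \<in> velocities" "Z \<in> state_space Nx Ny"
  shows "cn_op \<tau> \<nu> F A Z \<in> state_space Nx Ny"
  using assms
  by (auto simp: cn_op_def state_space_def
      intro!: velocity_closed cn_velocity_op_closed grad_closed add_carrier_mat smult_carrier_mat)

lemma cn_op_linear: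
  assumes A: "A \<in> velocities" "F A \<in> velocities"
    and Y: "Y \<in> state_space Nx Ny" and Z: "Z \<in> state_space Nx Ny"
  shows "cn_op \<tau> \<nu> F A (Y + Z) = cn_op \<tau> \<nu> F A Y + cn_op \<tau> \<nu> F A Z"
    "cn_op \<tau> \<nu> F A (smult_state c Z) = smult_state c (cn_op \<tau> \<nu> F A Z)"
proof -
  obtain U P W Q where [simp]: "Y = (U, P)" "Z = (W, Q)" and
    c: "U \<in> velocities" "W \<in> velocities" "P \<in> grid_space Nx Ny" "Q \<in> grid_space Nx Ny"
    using Y Z by (auto simp: state_space_def)
  note cl = c div_closed[OF c(1)] div_closed[OF c(2)] grad_closed[OF c(3)] grad_closed[OF c(4)]
    cn_velocity_op_closed[where A = A and F = F, OF A c(1), of \<tau> \<nu>]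
    cn_velocity_op_closed[where A = A and F = F, OF A c(2), of \<tau> \<nu>]
  have "cn_velocity_op \<tau> \<nu> F A (U + W) + grad_h (P + Q)
      = (cn_velocity_op \<tau> \<nu> F A U + grad_h P) + (cn_velocity_op \<tau> \<nu> F A W + grad_h Q)"
    "cn_velocity_op \<tau> \<nu> F A (c \<cdot>\<^sub>p W) + grad_h (c \<cdot>\<^sub>m Q)
      = c \<cdot>\<^sub>p (cn_velocity_op \<tau> \<nu> F A W + grad_h Q)"
    using cl A
    by (auto intro!: velocity_eqI velocity_closed smult_velocity_closed
        simp: cn_velocity_op_linear grad_linear velocityD algebra_simps)
  moreover have "div_h (U + W) + inner_h hx hy (P + Q) ones \<cdot>\<^sub>m ones
      = (div_h U + inner_h hx hy P ones \<cdot>\<^sub>m ones) + (div_h W + inner_h hx hy Q ones \<cdot>\<^sub>m ones)"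
    "div_h (c \<cdot>\<^sub>p W) + inner_h hx hy (c \<cdot>\<^sub>m Q) ones \<cdot>\<^sub>m ones
      = c \<cdot>\<^sub>m (div_h W + inner_h hx hy Q ones \<cdot>\<^sub>m ones)"
    using cl
    by (auto simp: div_linear inner_h_linear[of _ Nx Ny] ones_mat_def algebra_simps intro!: eq_matI)
  ultimately show "cn_op \<tau> \<nu> F A (Y + Z) = cn_op \<tau> \<nu> F A Y + cn_op \<tau> \<nu> F A Z"
    "cn_op \<tau> \<nu> F A (smult_state c Z) = smult_state c (cn_op \<tau> \<nu> F A Z)"
    by (simp_all add: cn_op_def smult_state_def)
qed

text \<open>
  Divergences are orthogonal to the all-ones grid function, so the two summands must vanish separately.
\<close>

lemma continuity_and_mean_decouple:
  assumes W: "W \<in> velocities"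
  shows "div_h W + c \<cdot>\<^sub>m ones = 0\<^sub>m Nx Ny \<longleftrightarrow> div_h W = 0\<^sub>m Nx Ny \<and> c = 0"
proof
  assume con: "div_h W + c \<cdot>\<^sub>m ones = 0\<^sub>m Nx Ny"
  have "inner_h hx hy (div_h W + c \<cdot>\<^sub>m ones) ones = c * inner_h hx hy ones ones"
    using div_closed[OF W] by (simp add: inner_h_linear[of _ Nx Ny] div_mean_zero[OF W])
  moreover have "inner_h hx hy ones ones = hx * hy * (real Nx * real Ny)"
    by (simp add: inner_h_eq_sum[of _ Nx Ny]) (simp add: ones_mat_def)
  ultimately have c: "c = 0"
    using con positive by (simp add: inner_h_zero_left)
  have "div_h W + 0 \<cdot>\<^sub>m ones = div_h W"
    using div_closed[OF W] by (auto simp: ones_mat_def)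
  with con c show "div_h W = 0\<^sub>m Nx Ny \<and> c = 0" by simp
qed (auto simp: ones_mat_def)

text \<open>
  Testing the homogeneous momentum equation with \<open>W\<close> removes the pressure, and coercivity forces
  \<open>W = 0\<close>. The momentum equation then says that the pressure has zero gradient, and its mean is zero.
\<close>

lemma cn_op_kernel:
  assumes A: "A \<in> velocities" "F A \<in> velocities" and pos: "\<tau> > 0" "\<nu> > 0"
    and Z: "Z \<in> state_space Nx Ny" and 0: "cn_op \<tau> \<nu> F A Z = zero_state Nx Ny"
  shows "Z = zero_state Nx Ny"
proof -
  obtain W P where [simp]: "Z = (W, P)" and W: "W \<in> velocities" and P: "P \<in> grid_space Nx Ny"
    using Z by (auto simp: state_space_def)
  define c where "c = inner_h hx hy P ones"
  have mom: "cn_velocity_op \<tau> \<nu> F A W + grad_h P = zero_pair Nx Ny"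
    and con: "div_h W + c \<cdot>\<^sub>m ones = 0\<^sub>m Nx Ny"
    using 0 by (simp_all add: cn_op_def zero_state_def c_def)
  have c: "c = 0" and div: "div_h W = 0\<^sub>m Nx Ny"
    using con continuity_and_mean_decouple[OF W] by auto
  have zW: "ip (zero_pair Nx Ny) W = 0"
    using W by (auto simp: inner_pair_h_def zero_pair_def inner_h_zero_left velocity_space_def)
  have "inner_h hx hy P (div_h W) = 0"
    unfolding div using P by (simp add: inner_h_eq_sum[of _ Nx Ny])
  then have "ip (cn_velocity_op \<tau> \<nu> F A W) W = ip (cn_velocity_op \<tau> \<nu> F A W + grad_h P) W"
    using W P A by (simp add: ip_add cn_velocity_op_closed grad_closed grad_adjoint_div)
  also have "\<dots> = 0" by (simp add: mom zW)
  finally have "2 / \<tau> * ip W W \<le> 0"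
    using cn_velocity_op_coercive[where A = A and F = F, OF A W pos(2), of \<tau>] by simp
  then have "ip W W \<le> 0" using pos(1) by (simp add: field_simps mult_le_0_iff)
  then have W0: "W = zero_pair Nx Ny" by (rule ip_definite[OF W])
  have zero: "0 \<cdot>\<^sub>p U = zero_pair Nx Ny" if "U \<in> velocities" for U
    using that by (intro velocity_eqI)
      (auto simp: velocityD zero_pair_def smult_velocity_closed, auto simp: velocity_space_def)
  have "cn_velocity_op \<tau> \<nu> F A W = zero_pair Nx Ny"
    using cn_velocity_op_linear(2)[where A = A and F = F, OF A W W, of \<tau> \<nu> 0]
    by (simp add: zero W cn_velocity_op_closed[where A = A and F = F, OF A W]) (simp add: W0)
  then have "grad_h P = zero_pair Nx Ny"
    using mom grad_closed[OF P] by (auto simp: zero_pair_def velocity_space_def)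
  then have "P = 0\<^sub>m Nx Ny"
    by (rule grad_kernel[OF P]) (use c in \<open>simp add: c_def\<close>)
  with W0 show ?thesis by (simp add: zero_state_def)
qed

lemma CN_step_iff:
  assumes A: "A \<in> velocities" "F A \<in> velocities" and pos: "\<tau> > 0" and f: "f \<in> velocities"
    and U: "U0 \<in> velocities" "U1 \<in> velocities" and P: "P \<in> grid_space Nx Ny"
  shows "inner_h hx hy P ones = 0 \<and> CN_step Nx Ny hx hy \<tau> \<nu> F f A U0 U1 P \<longleftrightarrow>
    cn_op \<tau> \<nu> F A ((1 / 2) \<cdot>\<^sub>p (U0 + U1), P) = (f + (2 / \<tau>) \<cdot>\<^sub>p U0, 0\<^sub>m Nx Ny)"
proof -
  define W where "W = (1 / 2) \<cdot>\<^sub>p (U0 + U1)"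
  have W: "W \<in> velocities" unfolding W_def by (intro smult_velocity_closed velocity_closed U)
  define M where "M = (1 / \<tau>) \<cdot>\<^sub>p (U1 - U0) - \<nu> \<cdot>\<^sub>p laplace_pair_h Nx Ny hx hy W
    + op_B Nx Ny hx hy F A W + grad_h P"
  note cl = U f grad_closed[OF P] laplace_closed[OF W] op_B_closed[of A F W, OF A]
  have M: "M \<in> velocities"
    unfolding M_def by (intro smult_velocity_closed velocity_closed cl)
  have "cn_velocity_op \<tau> \<nu> F A W + grad_h P = M + (2 / \<tau>) \<cdot>\<^sub>p U0"
  proof (rule velocity_eqI)
    show "cn_velocity_op \<tau> \<nu> F A W + grad_h P \<in> velocities" "M + (2 / \<tau>) \<cdot>\<^sub>p U0 \<in> velocities"
      by (intro smult_velocity_closed velocity_closed cl M cn_velocity_op_closed A W)+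
  qed (use cl W pos in \<open>auto simp: M_def cn_velocity_op_def velocityD W_def field_simps\<close>)
  moreover have "M + (2 / \<tau>) \<cdot>\<^sub>p U0 = f + (2 / \<tau>) \<cdot>\<^sub>p U0 \<longleftrightarrow> M = f"
  proof
    assume *: "M + (2 / \<tau>) \<cdot>\<^sub>p U0 = f + (2 / \<tau>) \<cdot>\<^sub>p U0"
    show "M = f"
    proof (rule velocity_eqI[OF M f])
      fix i j assume "i < Nx" "j < Ny"
      then show "fst M $$ (i, j) = fst f $$ (i, j)" "snd M $$ (i, j) = snd f $$ (i, j)"
        using arg_cong[OF *, of "\<lambda>X. fst X $$ (i, j)"] arg_cong[OF *, of "\<lambda>X. snd X $$ (i, j)"] cl
        by (simp_all add: velocityD)
    qed
  qed simp
  ultimately show ?thesis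
    using continuity_and_mean_decouple[OF W, of "inner_h hx hy P ones"]
    by (auto simp: CN_step_def cn_op_def Let_def M_def simp flip: W_def)
qed

text \<open>
  One lemma serves both schemes, since \<open>A\<close>, where \<open>F\<close> and \<open>G\<close> are evaluated, is known at the start
  of the step and may be any velocity. This is why each step is a linear problem.
\<close>

lemma CN_step_uniquely_solvable:
  assumes A: "A \<in> velocities" "F A \<in> velocities" and pos: "\<tau> > 0" "\<nu> > 0"
    and f: "f \<in> velocities" and U0: "U0 \<in> velocities"
  shows "\<exists>!X. X \<in> {(U1, P). U1 \<in> velocities \<and> P \<in> grid_space Nx Ny
    \<and> inner_h hx hy P ones = 0 \<and> CN_step Nx Ny hx hy \<tau> \<nu> F f A U0 U1 P}"
proof -
  define R :: "mat_pair \<times> real mat" where "R = (f + (2 / \<tau>) \<cdot>\<^sub>p U0, 0\<^sub>m Nx Ny)"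
  have "R \<in> state_space Nx Ny"
    by (simp add: R_def state_space_def velocity_closed smult_velocity_closed f U0)
  then have ex1: "\<exists>!Z. Z \<in> state_space Nx Ny \<and> cn_op \<tau> \<nu> F A Z = R"
    by (intro linear_state_equation_unique_solution)
      (auto simp: cn_op_closed[where A = A and F = F, OF A] cn_op_linear[where A = A and F = F, OF A]
        dest: cn_op_kernel[where A = A and F = F, OF A pos])
  \<comment> \<open>The unknown of the scheme is \<open>U\<^sup>n\<^sup>+\<^sup>1\<close>, that of the linear system the half-step velocity;
    they determine each other.\<close>
  define mid where "mid U1 = (1 / 2) \<cdot>\<^sub>p (U0 + U1)" for U1
  have mid: "mid U1 \<in> velocities" if "U1 \<in> velocities" for U1
    unfolding mid_def using that U0 by (intro smult_velocity_closed velocity_closed)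
  have surj: "2 \<cdot>\<^sub>p W - U0 \<in> velocities" "mid (2 \<cdot>\<^sub>p W - U0) = W" if "W \<in> velocities" for W
  proof -
    show *: "2 \<cdot>\<^sub>p W - U0 \<in> velocities" using that U0 by (intro smult_velocity_closed velocity_closed)
    show "mid (2 \<cdot>\<^sub>p W - U0) = W"
      by (rule velocity_eqI[OF mid[OF *] that]) (use that U0 in \<open>auto simp: mid_def velocityD\<close>)
  qed
  have inj: "U = U'" if "U \<in> velocities" "U' \<in> velocities" "mid U = mid U'" for U U'
  proof (rule velocity_eqI[OF that(1,2)])
    fix i j assume "i < Nx" "j < Ny"
    then show "fst U $$ (i, j) = fst U' $$ (i, j)" "snd U $$ (i, j) = snd U' $$ (i, j)"
      using arg_cong[OF that(3), of "\<lambda>X. fst X $$ (i, j)"]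
        arg_cong[OF that(3), of "\<lambda>X. snd X $$ (i, j)"] that(1,2) U0
      by (simp_all add: mid_def velocityD)
  qed
  have iff: "(U1, P) \<in> {(U1, P). U1 \<in> velocities \<and> P \<in> grid_space Nx Ny
      \<and> inner_h hx hy P ones = 0 \<and> CN_step Nx Ny hx hy \<tau> \<nu> F f A U0 U1 P} \<longleftrightarrow>
    U1 \<in> velocities \<and> P \<in> grid_space Nx Ny \<and> cn_op \<tau> \<nu> F A (mid U1, P) = R" for U1 P
    using CN_step_iff[where A = A and F = F, OF A pos(1) f U0, of U1 P \<nu>] by (auto simp: R_def mid_def)
  from ex1 obtain W P where W: "W \<in> velocities" and P: "P \<in> grid_space Nx Ny"
    and WP: "cn_op \<tau> \<nu> F A (W, P) = R"
    by (auto simp: state_space_def)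
  show ?thesis
  proof (rule ex1I[of _ "(2 \<cdot>\<^sub>p W - U0, P)"])
    show "(2 \<cdot>\<^sub>p W - U0, P) \<in> {(U1, P). U1 \<in> velocities \<and> P \<in> grid_space Nx Ny
      \<and> inner_h hx hy P ones = 0 \<and> CN_step Nx Ny hx hy \<tau> \<nu> F f A U0 U1 P}"
      unfolding iff using surj[OF W] P WP by simp
  next
    fix X assume X: "X \<in> {(U1, P). U1 \<in> velocities \<and> P \<in> grid_space Nx Ny
      \<and> inner_h hx hy P ones = 0 \<and> CN_step Nx Ny hx hy \<tau> \<nu> F f A U0 U1 P}"
    obtain U1 Q where [simp]: "X = (U1, Q)" by (cases X)
    have U1: "U1 \<in> velocities" and Q: "Q \<in> grid_space Nx Ny" and
      eq: "cn_op \<tau> \<nu> F A (mid U1, Q) = R"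
      using X unfolding \<open>X = (U1, Q)\<close> iff by auto
    have "(mid U1, Q) = (W, P)"
      using ex1 U1 Q eq W P WP mid[OF U1] by (auto simp: state_space_def)
    then show "X = (2 \<cdot>\<^sub>p W - U0, P)"
      using inj[OF U1 surj(1)[OF W]] surj(2)[OF W] by simp
  qed
qed

end

section \<open>Unique solvability of both schemes\<close>

theorem theorem4p2:
  fixes Nx Ny Nt :: nat
    and Lx Ly hx hy T \<tau> \<nu> :: real
    and F :: "mat_pair \<Rightarrow> mat_pair"
    and f :: "nat \<Rightarrow> mat_pair"
    and U0 :: mat_pair
  assumes "Nx > 0" and "Ny > 0" and "Nt > 0"
    and "Lx > 0" and "Ly > 0" and "T > 0"
    and "hx = Lx / real Nx" and "hy = Ly / real Ny" and "\<tau> = T / real Nt"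
    and "\<nu> > 0" and "\<tau> > 0"
    and "F \<in> velocity_space Nx Ny \<rightarrow> velocity_space Nx Ny"
    and "\<And>U. U \<in> velocity_space Nx Ny \<Longrightarrow> norm_pair_h hx hy U \<noteq> 0
              \<Longrightarrow> inner_pair_h hx hy (F U) U \<noteq> 0"
    and "\<And>n. n < Nt \<Longrightarrow> f n \<in> velocity_space Nx Ny"
    and "U0 \<in> velocity_space Nx Ny"
  shows "(\<forall>n\<in>{0..<Nt}. \<forall>U. CN1_computed Nx Ny hx hy \<tau> \<nu> F f U0 U n \<longrightarrow>
            (\<exists>!X. X \<in> CN1_solutions Nx Ny hx hy \<tau> \<nu> F f U n))
       \<and> (\<forall>n\<in>{1..<Nt}. \<forall>U. CN2_computed Nx Ny hx hy \<tau> \<nu> F f U0 U n \<longrightarrow>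
            (\<exists>!X. X \<in> CN2_solutions Nx Ny hx hy \<tau> \<nu> F f U n))"
proof -
  have "hx > 0" using assms(1,4,7) by simp
  moreover have "hy > 0" using assms(2,5,8) by simp
  ultimately interpret staggered_grid Nx Ny hx hy
    using assms(1,2) by unfold_locales auto
  have F: "F A \<in> velocities" if "A \<in> velocities" for A
    using assms(12) that by blast
  have CN1_step: "\<exists>!X. X \<in> CN1_solutions Nx Ny hx hy \<tau> \<nu> F f U n"
    if "n < Nt" "U n \<in> velocities" for U n
    unfolding CN1_solutions_def
    using that F assms(10,11,14) by (intro CN_step_uniquely_solvable) auto
  have CN2_step: "\<exists>!X. X \<in> CN2_solutions Nx Ny hx hy \<tau> \<nu> F f U n"
    if "n < Nt" "U n \<in> velocities" "U (n - 1) \<in> velocities" for U n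
  proof -
    have "(1 / 2) \<cdot>\<^sub>p (3 \<cdot>\<^sub>p U n - U (n - 1)) \<in> velocities"
      using that by (intro smult_velocity_closed velocity_closed)
    then show ?thesis
      unfolding CN2_solutions_def
      using that F assms(10,11,14) by (intro CN_step_uniquely_solvable) auto
  qed
  have CN1_velocity: "U n \<in> velocities" if "CN1_computed Nx Ny hx hy \<tau> \<nu> F f U0 U n" for U n
    using that assms(15) by (cases n) (auto simp: CN1_computed_def CN1_solutions_def)
  have CN2_velocity: "U m \<in> velocities"
    if "CN2_computed Nx Ny hx hy \<tau> \<nu> F f U0 U n" "m \<le> n" for U n m
  proof (cases m)
    case 0
    then show ?thesis using that assms(15) by (simp add: CN2_computed_def)
  next
    case (Suc k)
    then show ?thesis using that
      by (cases "k = 0") (fastforce simp: CN2_computed_def CN1_solutions_def CN2_solutions_def)+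
  qed
  show ?thesis
    using CN1_step CN1_velocity CN2_step CN2_velocity by auto
qed

end
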